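(* Fix a symmetrizable generalized Cartan matrix $A=(a_{i,i'})_{i,i'\in[1,r]}$. For any signed word $\mathbf{i}^\dagger=(i_1^\dagger,\dots,i_n^\dagger)$ in $[1,r]$, the matrix $\widehat M(\mathbf{i}^\dagger)\in\mathrm{Mat}_{n\times n}(\mathbb{Z})$ is given by $$\widehat M(\mathbf{i}^\dagger)=E(\mathbf{i}^\dagger)^t\,Q(\mathbf{i}^\dagger)\,E(\mathbf{i}^\dagger).$$ Writing $\widehat M(\mathbf{i}^\dagger)=(\widehat m_{j,k})_{j,k\in[1,n]}$, for all $j,k\in[1,n]$, including when $j[1]=+\infty$ or $k[1]=+\infty$, one has $$\widehat m_{j,k}=\begin{cases} -\varepsilon_k, & j[1]=k,\\ \varepsilon_j, & j=k[1],\\ 1, & j=k\text{ and }k[1]=+\infty,\\ -\varepsilon_k\,a_{|i_j^\dagger|,|i_k^\dagger|}, & j<k<j[1]<k[1]\text{ and }\varepsilon_k=\varepsilon_{j[1]},\\ & \text{or } j<k<k[1]<j[1]\text{ and }\varepsilon_k=-\varepsilon_{k[1]},\\ \varepsilon_j\,a_{|i_j^\dagger|,|i_k^\dagger|}, & k<j<k[1]<j[1]\text{ and }\varepsilon_j=\varepsilon_{k[1]},\\ & \text{or } k<j<j[1]<k[1]\text{ and }\varepsilon_j=-\varepsilon_{j[1]},\\ 0, & \text{otherwise}. \end{cases}$$ Here, by convention, $\varepsilon_{+\infty}=-1$, and when $j[1]=k[1]=+\infty$ the inequality $j[1]<k[1]$ is regarded as true and $k[1]<j[1]$ as false.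
   Context: $[a,b]$ is the set of integers between $a$ and $b$. $e_1,\dots,e_n$ is the standard basis of column vectors, $e_{+\infty}:=0$. A permutation $\tau\in S_n$ also denotes the matrix with columns $e_{\tau(1)},\dots,e_{\tau(n)}$. A generalized Cartan matrix is an integer matrix with $a_{i,i}=2$, $a_{i,i'}\le0$ for $i\ne i'$, and $a_{i,i'}=0\iff a_{i',i}=0$; symmetrizable means there are positive integers $d_i$ with $d_ia_{i,i'}=d_{i'}a_{i',i}$. A signed word in $[1,r]$ is a sequence $\mathbf{i}^\dagger=(i_1^\dagger,\dots,i_n^\dagger)$ with $i_j^\dagger\in[-r,-1]\sqcup[1,r]$ ($n\ge2$); put $\varepsilon_j=\mathrm{sign}(i_j^\dagger)$. Definition of $\widehat M(\mathbf{i}^\dagger)$. Let $a_1<\dots<a_m$ be the positions of the positive entries of $\mathbf{i}^\dagger$ and $b_1<\dots<b_{n-m}$ those of the negative entries. Let $\mathbf{i}=(i_1,\dots,i_n)=(i^\dagger_{a_m},\dots,i^\dagger_{a_1},-i^\dagger_{b_1},\dots,-i^\dagger_{b_{n-m}})$ and let $\tau\in S_n$ be given by $\tau(a_t)=m+1-t$ for $t\in[1,m]$, $\tau(b_t)=m+t$ for $t\in[1,n-m]$. Let $s_\tau(j)=\min\{j'\in[j+1,n]:i_{\tau(j')}=i_{\tau(j)}\}$ ($+\infty$ if the set is empty), $E_\tau$ the $n\times n$ matrix with $j$-th column $e_j-e_{s_\tau(j)}$, and $Q$ the upper triangular matrix with diagonal entries $1$ and $(j,k)$-entry $a_{i_j,i_k}$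 for $j<k$. Then $\widehat M(\mathbf{i}^\dagger):=(\tau E_\tau)^tQ\,\tau E_\tau$. Definition of $E(\mathbf{i}^\dagger),Q(\mathbf{i}^\dagger)$. For $j\in[1,n]$, $j[1]=\min\{j'\in[j+1,n]:|i^\dagger_{j'}|=|i^\dagger_j|\}$ if this set is non-empty and $j[1]=+\infty$ otherwise. $E(\mathbf{i}^\dagger)$ is the $n\times n$ matrix with $j$-th column $e_j-e_{j[1]}$. Let $\mathcal{P}(\mathbf{i}^\dagger)$ be the set of pairs $(j,k)\in[1,n]^2$ such that: $\varepsilon_j=1$ and $\varepsilon_k=-1$; or $\varepsilon_j=\varepsilon_k=1$ and $j>k$; or $\varepsilon_j=\varepsilon_k=-1$ and $j<k$. $Q(\mathbf{i}^\dagger)$ is the $n\times n$ matrix with $(j,k)$-entry $1$ if $j=k$, $a_{|i_j^\dagger|,|i_k^\dagger|}$ if $(j,k)\in\mathcal{P}(\mathbf{i}^\dagger)$, and $0$ otherwise. *)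

theory Defs
  imports
    "Jordan_Normal_Form.Matrix"
    "HOL-Library.Extended_Nat"
    "HOL-Combinatorics.Permutations"
begin

(* Library matrices, vectors and lists are indexed from 0; the positions, letters and
   matrix indices below all run from 1. *)

definition entry :: "int mat \<Rightarrow> nat \<Rightarrow> nat \<Rightarrow> int" where
  "entry M j k = M $$ (j - 1, k - 1)"

definition mat_of_entries :: "nat \<Rightarrow> (nat \<Rightarrow> nat \<Rightarrow> int) \<Rightarrow> int mat" where
  "mat_of_entries n f = mat n n (\<lambda>(j, k). f (j + 1) (k + 1))"

definition mat_of_columns :: "nat \<Rightarrow> (nat \<Rightarrow> int vec) \<Rightarrow> int mat" where
  "mat_of_columns n c = mat_of_cols n (map c [1..<n + 1])"

definition basis_vec :: "nat \<Rightarrow> enat \<Rightarrow> int vec" where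
  "basis_vec n x = (case x of enat j \<Rightarrow> unit_vec n (j - 1) | \<infinity> \<Rightarrow> 0\<^sub>v n)"

definition perm_mat :: "nat \<Rightarrow> (nat \<Rightarrow> nat) \<Rightarrow> int mat" where
  "perm_mat n p = mat_of_columns n (\<lambda>j. basis_vec n (enat (p j)))"

definition generalized_Cartan_matrix :: "nat \<Rightarrow> int mat \<Rightarrow> bool" where
  "generalized_Cartan_matrix r A \<longleftrightarrow>
     A \<in> carrier_mat r r \<and>
     (\<forall>i\<in>{1..r}. entry A i i = 2) \<and>
     (\<forall>i\<in>{1..r}. \<forall>i'\<in>{1..r}. i \<noteq> i' \<longrightarrow> entry A i i' \<le> 0) \<and>
     (\<forall>i\<in>{1..r}. \<forall>i'\<in>{1..r}. entry A i i' = 0 \<longleftrightarrow> entry A i' i = 0)"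

definition symmetrizable :: "nat \<Rightarrow> int mat \<Rightarrow> bool" where
  "symmetrizable r A \<longleftrightarrow>
     (\<exists>d :: nat \<Rightarrow> int. (\<forall>i\<in>{1..r}. d i > 0) \<and>
        (\<forall>i\<in>{1..r}. \<forall>i'\<in>{1..r}. d i * entry A i i' = d i' * entry A i' i))"

definition signed_word :: "nat \<Rightarrow> int list \<Rightarrow> bool" where
  "signed_word r w \<longleftrightarrow> length w \<ge> 2 \<and> set w \<subseteq> {- int r..-1} \<union> {1..int r}"

definition letter :: "int list \<Rightarrow> nat \<Rightarrow> int" where
  "letter w j = w ! (j - 1)"

definition abs_letter :: "int list \<Rightarrow> nat \<Rightarrow> nat" where
  "abs_letter w j = nat \<bar>letter w j\<bar>"

definition eps :: "int list \<Rightarrow> enat \<Rightarrow> int" where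
  "eps w x = (case x of enat j \<Rightarrow> sgn (letter w j) | \<infinity> \<Rightarrow> -1)"

definition next_equal :: "nat \<Rightarrow> (nat \<Rightarrow> nat) \<Rightarrow> nat \<Rightarrow> enat" where
  "next_equal n f j =
     (if \<exists>j'\<in>{j + 1..n}. f j' = f j then enat (Min {j'\<in>{j + 1..n}. f j' = f j}) else \<infinity>)"

definition succ_mat :: "nat \<Rightarrow> (nat \<Rightarrow> enat) \<Rightarrow> int mat" where
  "succ_mat n s = mat_of_columns n (\<lambda>j. basis_vec n (enat j) - basis_vec n (s j))"


definition pos_positions :: "int list \<Rightarrow> nat list" where
  "pos_positions w = filter (\<lambda>j. letter w j > 0) [1..<length w + 1]"

definition neg_positions :: "int list \<Rightarrow> nat list" where
  "neg_positions w = filter (\<lambda>j. letter w j < 0) [1..<length w + 1]"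

definition unsigned_word :: "int list \<Rightarrow> nat list" where
  "unsigned_word w =
     map (\<lambda>j. nat (letter w j)) (rev (pos_positions w)) @
     map (\<lambda>j. nat (- letter w j)) (neg_positions w)"

definition unsigned_letter :: "int list \<Rightarrow> nat \<Rightarrow> nat" where
  "unsigned_letter w j = unsigned_word w ! (j - 1)"

(* With a_1 < ... < a_m the positive and b_1 < ... < b_(n-m) the negative positions, the
   cardinalities are the t with a_t = j, resp. b_t = j;
   see tau_pos_positions, tau_neg_positions and tau_permutes. *)
definition tau :: "int list \<Rightarrow> nat \<Rightarrow> nat" where
  "tau w j =
     (let m = length (pos_positions w) in
      if j \<notin> {1..length w} then j
      else if letter w j > 0 then m + 1 - card {j'\<in>{1..j}. letter w j' > 0}
      else m + card {j'\<in>{1..j}. letter w j' < 0})"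

lemma card_filter_upt:
  assumes "t \<in> {1..length (filter P [1..<n + 1])}"
  shows "card {j'\<in>{1..filter P [1..<n + 1] ! (t - 1)}. P j'} = t"
  using assms
proof (induction n)
  case 0
  then show ?case by simp
next
  case (Suc n)
  let ?l = "filter P [1..<n + 1]"
  have len: "length ?l = card {j'\<in>{1..n}. P j'}"
  proof -
    have "set ?l = {j'\<in>{1..n}. P j'}" by auto
    then show ?thesis by (metis distinct_card distinct_filter distinct_upt)
  qed
  have eq: "filter P [1..<Suc n + 1] = ?l @ (if P (Suc n) then [Suc n] else [])"
    by simp
  show ?case
  proof (cases "t \<le> length ?l")
    case True
    then have "filter P [1..<Suc n + 1] ! (t - 1) = ?l ! (t - 1)"
      using Suc.prems unfolding eq by (auto simp: nth_append)
    then show ?thesis using Suc.IH True Suc.prems by simp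
  next
    case False
    then have P: "P (Suc n)" and t: "t = Suc (length ?l)"
      using Suc.prems unfolding eq by (auto split: if_splits)
    have "filter P [1..<Suc n + 1] ! (t - 1) = Suc n"
      unfolding eq t using P by (simp add: nth_append)
    moreover have "{j'\<in>{1..Suc n}. P j'} = insert (Suc n) {j'\<in>{1..n}. P j'}"
      using P by (auto simp: le_Suc_eq)
    ultimately show ?thesis using t len by simp
  qed
qed

lemma tau_pos_positions:
  assumes "t \<in> {1..length (pos_positions w)}"
  shows "tau w (pos_positions w ! (t - 1)) = length (pos_positions w) + 1 - t"
proof -
  have "pos_positions w ! (t - 1) \<in> set (pos_positions w)"
    using assms by (intro nth_mem) auto
  then have "pos_positions w ! (t - 1) \<in> {1..length w}" "letter w (pos_positions w ! (t - 1)) > 0"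
    by (auto simp: pos_positions_def simp del: upt_Suc)
  then show ?thesis
    using card_filter_upt[of t "\<lambda>j. letter w j > 0" "length w"] assms
    by (simp add: tau_def Let_def pos_positions_def del: upt_Suc)
qed

lemma tau_neg_positions:
  assumes "t \<in> {1..length (neg_positions w)}"
  shows "tau w (neg_positions w ! (t - 1)) = length (pos_positions w) + t"
proof -
  have "neg_positions w ! (t - 1) \<in> set (neg_positions w)"
    using assms by (intro nth_mem) auto
  then have "neg_positions w ! (t - 1) \<in> {1..length w}" "letter w (neg_positions w ! (t - 1)) < 0"
    by (auto simp: neg_positions_def simp del: upt_Suc)
  then show ?thesis
    using card_filter_upt[of t "\<lambda>j. letter w j < 0" "length w"] assms
    by (simp add: tau_def Let_def neg_positions_def del: upt_Suc)
qed

lemma tau_permutes: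
  assumes "signed_word r w"
  shows "tau w permutes {1..length w}"
proof -
  let ?n = "length w" and ?m = "length (pos_positions w)" and ?m' = "length (neg_positions w)"
  have nz: "letter w j \<noteq> 0" if "j \<in> {1..?n}" for j
  proof -
    have "letter w j \<in> set w" using that unfolding letter_def by (intro nth_mem) auto
    then show ?thesis using assms by (auto simp: signed_word_def)
  qed
  have "filter (\<lambda>j. \<not> letter w j > 0) [1..<?n + 1] = neg_positions w"
    unfolding neg_positions_def using nz by (intro filter_cong) force+
  then have n: "?m + ?m' = ?n"
    using sum_length_filter_compl[of "\<lambda>j. letter w j > 0" "[1..<?n + 1]"]
    by (simp add: pos_positions_def del: upt_Suc)
  have "{1..?n} \<subseteq> tau w ` {1..?n}"
  proof
    fix s assume s: "s \<in> {1..?n}"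
    show "s \<in> tau w ` {1..?n}"
    proof (cases "s \<le> ?m")
      case True
      define t where "t = ?m + 1 - s"
      have t: "t \<in> {1..?m}" "s = ?m + 1 - t" using True s by (auto simp: t_def)
      have "pos_positions w ! (t - 1) \<in> set (pos_positions w)" using t by (intro nth_mem) auto
      then have "pos_positions w ! (t - 1) \<in> {1..?n}" by (auto simp: pos_positions_def simp del: upt_Suc)
      then show ?thesis using tau_pos_positions[OF t(1)] t(2) by (metis imageI)
    next
      case False
      define t where "t = s - ?m"
      have t: "t \<in> {1..?m'}" "s = ?m + t" using False s n by (auto simp: t_def)
      have "neg_positions w ! (t - 1) \<in> set (neg_positions w)" using t by (intro nth_mem) auto
      then have "neg_positions w ! (t - 1) \<in> {1..?n}" by (auto simp: neg_positions_def simp del: upt_Suc)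
      then show ?thesis using tau_neg_positions[OF t(1)] t(2) by (metis imageI)
    qed
  qed
  then have "tau w ` {1..?n} = {1..?n}"
    by (metis card_image_le card_seteq finite_atLeastAtMost finite_imageI)
  then have "bij_betw (tau w) {1..?n} {1..?n}"
    by (simp add: bij_betw_def eq_card_imp_inj_on)
  then show ?thesis by (rule bij_imp_permutes) (auto simp: tau_def)
qed

definition s_tau :: "int list \<Rightarrow> nat \<Rightarrow> enat" where
  "s_tau w = next_equal (length w) (\<lambda>j. unsigned_letter w (tau w j))"

definition E_tau :: "int list \<Rightarrow> int mat" where
  "E_tau w = succ_mat (length w) (s_tau w)"

definition Q_unsigned :: "int mat \<Rightarrow> int list \<Rightarrow> int mat" where
  "Q_unsigned A w = mat_of_entries (length w) (\<lambda>j k.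
     if j = k then 1
     else if j < k then entry A (unsigned_letter w j) (unsigned_letter w k)
     else 0)"

definition M_hat :: "int mat \<Rightarrow> int list \<Rightarrow> int mat" where
  "M_hat A w =
     (let T = perm_mat (length w) (tau w)
      in transpose_mat (T * E_tau w) * Q_unsigned A w * (T * E_tau w))"


definition succ_pos :: "int list \<Rightarrow> nat \<Rightarrow> enat" where
  "succ_pos w = next_equal (length w) (abs_letter w)"

definition E_signed :: "int list \<Rightarrow> int mat" where
  "E_signed w = succ_mat (length w) (succ_pos w)"

definition P_pairs :: "int list \<Rightarrow> (nat \<times> nat) set" where
  "P_pairs w = {(j, k) \<in> {1..length w} \<times> {1..length w}.
     eps w (enat j) = 1 \<and> eps w (enat k) = -1 \<or>
     eps w (enat j) = 1 \<and> eps w (enat k) = 1 \<and> j > k \<or>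
     eps w (enat j) = -1 \<and> eps w (enat k) = -1 \<and> j < k}"

definition Q_signed :: "int mat \<Rightarrow> int list \<Rightarrow> int mat" where
  "Q_signed A w = mat_of_entries (length w) (\<lambda>j k.
     if j = k then 1
     else if (j, k) \<in> P_pairs w then entry A (abs_letter w j) (abs_letter w k)
     else 0)"

(* The strict order on the values j[1], k[1] for the row index j and the column index k: the tie
   at infinity counts as j[1] < k[1], and not as k[1] < j[1]. So row_less renders j[1] < k[1],
   while k[1] < j[1] is the strict order of enat. *)
definition row_less :: "enat \<Rightarrow> enat \<Rightarrow> bool" where
  "row_less x y \<longleftrightarrow> x < y \<or> x = \<infinity> \<and> y = \<infinity>"

definition m_hat_formula :: "int mat \<Rightarrow> int list \<Rightarrow> nat \<Rightarrow> nat \<Rightarrow> int" where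
  "m_hat_formula A w j k =
     (let j1 = succ_pos w j; k1 = succ_pos w k;
          a = entry A (abs_letter w j) (abs_letter w k)
      in
      if j1 = enat k then - eps w (enat k)
      else if enat j = k1 then eps w (enat j)
      else if j = k \<and> k1 = \<infinity> then 1
      else if j < k \<and> enat k < j1 \<and> row_less j1 k1 \<and> eps w (enat k) = eps w j1 \<or>
              j < k \<and> enat k < k1 \<and> k1 < j1 \<and> eps w (enat k) = - eps w k1
        then - eps w (enat k) * a
      else if k < j \<and> enat j < k1 \<and> k1 < j1 \<and> eps w (enat j) = eps w k1 \<or>
              k < j \<and> enat j < j1 \<and> row_less j1 k1 \<and> eps w (enat j) = - eps w j1
        then eps w (enat j) * a
      else 0)"

end

theory Submission
  imports Defs
begin

(* For positions j < k one has tau(j) < tau(k) exactly when the letter at k is negative. Hence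
   conjugating Q by tau gives Q(i), whose entry at two distinct positions depends only on the sign
   of the larger position. Writing this entry as (a/2) (1 + sigma), where sigma is plus or minus
   that sign according to whether the larger position is the row or the column index, the constant
   parts cancel in q(j,k) - q(j[1],k) - q(j,k[1]) + q(j[1],k[1]), also at infinity thanks to the
   conventions there, and the formula is read off from the relative order of j, k, j[1], k[1]. *)

section \<open>Matrices given by columns, and congruence by them\<close>

lemma mat_of_columns_carrier [simp]: "mat_of_columns n c \<in> carrier_mat n n"
  unfolding mat_of_columns_def using mat_of_cols_carrier(1)[of n "map c [1..<n + 1]"] by (simp del: upt_Suc)

lemma col_mat_of_columns:
  assumes "j \<in> {1..n}" "c j \<in> carrier_vec n"
  shows "col (mat_of_columns n c) (j - 1) = c j"
proof -
  have "map c [1..<n + 1] ! (j - 1) = c j"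
    using assms(1) by (subst nth_map) (auto simp del: upt_Suc)
  then show ?thesis
    unfolding mat_of_columns_def
    using col_mat_of_cols[of "j - 1" "map c [1..<n + 1]" n] assms by (auto simp del: upt_Suc)
qed

lemma mat_of_entries_carrier [simp]: "mat_of_entries n f \<in> carrier_mat n n"
  unfolding mat_of_entries_def by simp

lemma entry_mat_of_entries:
  assumes "j \<in> {1..n}" "k \<in> {1..n}"
  shows "entry (mat_of_entries n f) j k = f j k"
  using assms by (auto simp: entry_def mat_of_entries_def)

lemma mat_eq_entryI:
  assumes "M \<in> carrier_mat n n" "N \<in> carrier_mat n n"
    and "\<And>j k. j \<in> {1..n} \<Longrightarrow> k \<in> {1..n} \<Longrightarrow> entry M j k = entry N j k"
  shows "M = N"
proof (rule eq_matI)
  fix i j assume "i < dim_row N" "j < dim_col N"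
  then show "M $$ (i, j) = N $$ (i, j)"
    using assms(3)[of "i + 1" "j + 1"] assms(2) by (auto simp: entry_def)
qed (use assms in auto)

lemma basis_vec_carrier [simp]: "basis_vec n x \<in> carrier_vec n"
  by (auto simp: basis_vec_def split: enat.split)

text \<open>Rows of the transpose are columns of the matrix, so congruence evaluates the bilinear
  form of \<open>Q\<close> on pairs of columns.\<close>

lemma entry_congruence:
  assumes "Q \<in> carrier_mat n n" "j \<in> {1..n}" "k \<in> {1..n}"
    and "\<And>j. j \<in> {1..n} \<Longrightarrow> c j \<in> carrier_vec n"
  shows "entry (transpose_mat (mat_of_columns n c) * Q * mat_of_columns n c) j k
    = c j \<bullet> (Q *\<^sub>v c k)"
proof -
  let ?M = "mat_of_columns n c"
  have M: "?M \<in> carrier_mat n n" by simp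
  have jk: "j - 1 < n" "k - 1 < n" using assms(2,3) by auto
  have "transpose_mat ?M * Q * ?M = transpose_mat ?M * (Q * ?M)"
    using M assms(1) by (auto intro!: assoc_mult_mat[of _ n n _ n _ n])
  moreover have "(transpose_mat ?M * (Q * ?M)) $$ (j - 1, k - 1)
      = row (transpose_mat ?M) (j - 1) \<bullet> col (Q * ?M) (k - 1)"
    using carrier_matD[OF M] assms(1) jk by (intro index_mult_mat) simp_all
  ultimately have "entry (transpose_mat ?M * Q * ?M) j k
      = row (transpose_mat ?M) (j - 1) \<bullet> col (Q * ?M) (k - 1)"
    unfolding entry_def by simp
  also have "col (Q * ?M) (k - 1) = Q *\<^sub>v col ?M (k - 1)"
    by (rule col_mult2[OF assms(1) M jk(2)])
  also have "row (transpose_mat ?M) (j - 1) = col ?M (j - 1)"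
    using carrier_matD[OF M] jk by (intro row_transpose) simp
  finally show ?thesis
    using col_mat_of_columns[where c = c, OF assms(2) assms(4)[OF assms(2)]]
      col_mat_of_columns[where c = c, OF assms(3) assms(4)[OF assms(3)]] by simp
qed

text \<open>The value 0 at infinity matches \<open>basis_vec n \<infinity>\<close> being the zero
  vector: a missing successor contributes nothing to a bilinear expansion.\<close>

definition ext_entry :: "int mat \<Rightarrow> enat \<Rightarrow> enat \<Rightarrow> int" where
  "ext_entry Q x y =
     (case x of \<infinity> \<Rightarrow> 0 | enat j \<Rightarrow> (case y of \<infinity> \<Rightarrow> 0 | enat k \<Rightarrow> entry Q j k))"

lemma basis_vec_form:
  assumes Q: "Q \<in> carrier_mat n n"
    and x: "\<And>j. x = enat j \<Longrightarrow> j \<in> {1..n}" and y: "\<And>k. y = enat k \<Longrightarrow> k \<in> {1..n}"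
  shows "basis_vec n x \<bullet> (Q *\<^sub>v basis_vec n y) = ext_entry Q x y"
proof (cases x)
  case x': (enat j)
  then have j: "j - 1 < n" using x by force
  show ?thesis
  proof (cases y)
    case (enat k)
    then have k: "k - 1 < n" using y by force
    have "Q *\<^sub>v unit_vec n (k - 1) = col Q (k - 1)"
      using Q k by (intro eq_vecI) auto
    then show ?thesis
      using x' enat j k Q by (simp add: basis_vec_def ext_entry_def entry_def)
  next
    case infinity
    have "Q *\<^sub>v 0\<^sub>v n = 0\<^sub>v n" using Q by auto
    then show ?thesis using x' infinity by (simp add: basis_vec_def ext_entry_def)
  qed
next
  case infinity
  have "Q *\<^sub>v basis_vec n y \<in> carrier_vec n" using Q by auto
  then show ?thesis using infinity by (simp add: basis_vec_def[of n \<infinity>] ext_entry_def)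
qed

lemma entry_perm_mat_congruence:
  assumes "Q \<in> carrier_mat n n" "p permutes {1..n}" "j \<in> {1..n}" "k \<in> {1..n}"
  shows "entry (transpose_mat (perm_mat n p) * Q * perm_mat n p) j k = entry Q (p j) (p k)"
proof -
  have "p j \<in> {1..n}" "p k \<in> {1..n}"
    using permutes_in_image[OF assms(2)] assms(3,4) by blast+
  then have "basis_vec n (enat (p j)) \<bullet> (Q *\<^sub>v basis_vec n (enat (p k))) = entry Q (p j) (p k)"
    by (subst basis_vec_form[OF assms(1)]) (auto simp: ext_entry_def)
  then show ?thesis
    unfolding perm_mat_def using entry_congruence[OF assms(1,3,4)] by simp
qed

text \<open>Each column is a difference of two basis vectors, so bilinearity gives four terms; those
  with an infinite index vanish.\<close>

lemma entry_succ_mat_congruence: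
  assumes Q: "Q \<in> carrier_mat n n" and jk: "j \<in> {1..n}" "k \<in> {1..n}"
    and s: "\<And>j i. j \<in> {1..n} \<Longrightarrow> s j = enat i \<Longrightarrow> i \<in> {1..n}"
  shows "entry (transpose_mat (succ_mat n s) * Q * succ_mat n s) j k
    = ext_entry Q (enat j) (enat k) - ext_entry Q (s j) (enat k)
      - ext_entry Q (enat j) (s k) + ext_entry Q (s j) (s k)"
proof -
  have form: "basis_vec n x \<bullet> (Q *\<^sub>v basis_vec n y) = ext_entry Q x y"
    if "x \<in> {enat j, s j}" "y \<in> {enat k, s k}" for x y
    using that s[OF jk(1)] s[OF jk(2)] jk by (intro basis_vec_form[OF Q]) auto
  have car: "Q *\<^sub>v basis_vec n y \<in> carrier_vec n" for y using Q by auto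
  have "entry (transpose_mat (succ_mat n s) * Q * succ_mat n s) j k
    = (basis_vec n (enat j) - basis_vec n (s j)) \<bullet>
      (Q *\<^sub>v (basis_vec n (enat k) - basis_vec n (s k)))"
    unfolding succ_mat_def using Q jk by (simp add: entry_congruence del: atLeastAtMost_iff)
  also have "Q *\<^sub>v (basis_vec n (enat k) - basis_vec n (s k))
    = Q *\<^sub>v basis_vec n (enat k) - Q *\<^sub>v basis_vec n (s k)"
    by (rule mult_minus_distrib_mat_vec[OF Q]) auto
  finally show ?thesis
    by (simp add: minus_scalar_prod_distrib[where n = n] scalar_prod_minus_distrib[where n = n] car form)
qed

section \<open>Next occurrences and order signs\<close>

lemma next_equal_enatD:
  assumes "next_equal n f j = enat i"
  shows "j < i" "i \<le> n" "f i = f j" "\<And>i'. j < i' \<Longrightarrow> i' < i \<Longrightarrow> f i' \<noteq> f j"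
proof -
  let ?S = "{j' \<in> {j + 1..n}. f j' = f j}"
  have ne: "?S \<noteq> {}" and i: "i = Min ?S"
    using assms by (auto simp: next_equal_def split: if_splits)
  have "i \<in> ?S" unfolding i by (rule Min_in[OF _ ne]) auto
  then show 1: "j < i" "i \<le> n" "f i = f j" by auto
  fix i' assume "j < i'" "i' < i"
  then show "f i' \<noteq> f j"
    using Min_le[of ?S i'] 1(2) i by fastforce
qed

lemma next_equal_cong:
  assumes "\<And>i. i \<in> {1..n} \<Longrightarrow> f i = g i" "j \<in> {1..n}"
  shows "next_equal n f j = next_equal n g j"
proof -
  have "{j' \<in> {j + 1..n}. f j' = f j} = {j' \<in> {j + 1..n}. g j' = g j}"
    using assms by auto
  then show ?thesis unfolding next_equal_def by auto
qed

lemma succ_mat_cong: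
  assumes "\<And>j. j \<in> {1..n} \<Longrightarrow> s j = s' j"
  shows "succ_mat n s = succ_mat n s'"
  unfolding succ_mat_def mat_of_columns_def
  by (rule arg_cong[where f = "mat_of_cols n"], rule map_cong) (use assms in auto)

text \<open>This is the sigma for which twice an entry of \<open>Q_signed\<close> is a times 1 +
  sigma. A finite tie gets 0; the tie at infinity falls under \<open>row_less\<close> and gets
  1.\<close>

definition order_sign :: "int list \<Rightarrow> enat \<Rightarrow> enat \<Rightarrow> int" where
  "order_sign w x y =
     (if row_less x y then - eps w y else if y < x then eps w x else 0)"

lemma order_sign_simps:
  "x < y \<Longrightarrow> order_sign w x y = - eps w y"
  "y < x \<Longrightarrow> order_sign w x y = eps w x"
  "order_sign w (enat i) (enat i) = 0"
  "order_sign w \<infinity> \<infinity> = 1"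
  by (auto simp: order_sign_def row_less_def eps_def)

section \<open>The permutation \<open>tau\<close> and the order of positions\<close>

lemma pos_positionE:
  assumes "j \<in> {1..length w}" "letter w j > 0"
  obtains t where "t \<in> {1..length (pos_positions w)}" "pos_positions w ! (t - 1) = j"
    "tau w j = length (pos_positions w) + 1 - t"
proof -
  have "j \<in> set (pos_positions w)" using assms by (auto simp: pos_positions_def simp del: upt_Suc)
  then obtain i where i: "i < length (pos_positions w)" "pos_positions w ! i = j"
    by (auto simp: in_set_conv_nth)
  show ?thesis
    using that[of "i + 1"] tau_pos_positions[of "i + 1" w] i by auto
qed

lemma neg_positionE:
  assumes "j \<in> {1..length w}" "letter w j < 0"
  obtains t where "t \<in> {1..length (neg_positions w)}" "neg_positions w ! (t - 1) = j"
    "tau w j = length (pos_positions w) + t"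
proof -
  have "j \<in> set (neg_positions w)" using assms by (auto simp: neg_positions_def simp del: upt_Suc)
  then obtain i where i: "i < length (neg_positions w)" "neg_positions w ! i = j"
    by (auto simp: in_set_conv_nth)
  show ?thesis
    using that[of "i + 1"] tau_neg_positions[of "i + 1" w] i by auto
qed

lemma Q_signed_carrier: "Q_signed A w \<in> carrier_mat (length w) (length w)"
  by (simp add: Q_signed_def)

lemma succ_posD:
  assumes "succ_pos w j = enat i"
  shows "j < i" "i \<in> {1..length w}" "abs_letter w i = abs_letter w j"
    "\<And>i'. j < i' \<Longrightarrow> i' < i \<Longrightarrow> abs_letter w i' \<noteq> abs_letter w j"
  using next_equal_enatD[of "length w" "abs_letter w" j i] assms by (auto simp: succ_pos_def)

context
  fixes r :: nat and w :: "int list"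
  assumes w: "signed_word r w"
begin

lemma letter_range:
  assumes "j \<in> {1..length w}"
  shows "letter w j \<noteq> 0" "abs_letter w j \<in> {1..r}"
proof -
  have "letter w j \<in> set w" using assms unfolding letter_def by (intro nth_mem) auto
  then have "letter w j \<in> {- int r..-1} \<union> {1..int r}" using w by (auto simp: signed_word_def)
  then show "letter w j \<noteq> 0" "abs_letter w j \<in> {1..r}"
    by (auto simp: abs_letter_def)
qed

text \<open>With m positive letters, \<open>tau\<close> sends the t-th positive position to slot m +
  1 - t, where the reversal in \<open>unsigned_word\<close> puts its letter; the negative letters
  follow in order, negated.\<close>

lemma unsigned_letter_tau:
  assumes j: "j \<in> {1..length w}"
  shows "unsigned_letter w (tau w j) = abs_letter w j"
proof (cases "letter w j > 0")
  case True
  from pos_positionE[OF j True] obtain t where t: "t \<in> {1..length (pos_positions w)}"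
    "pos_positions w ! (t - 1) = j" "tau w j = length (pos_positions w) + 1 - t" by metis
  have lt: "tau w j - 1 < length (pos_positions w)"
    and idx: "length (pos_positions w) - Suc (tau w j - 1) = t - 1"
    using t(1,3) by auto
  show ?thesis
    unfolding unsigned_letter_def unsigned_word_def
    using lt idx True t(2) by (simp add: nth_append rev_nth abs_letter_def)
next
  case False
  then have neg: "letter w j < 0" using letter_range(1)[OF j] by linarith
  from neg_positionE[OF j this] obtain t where t: "t \<in> {1..length (neg_positions w)}"
    "neg_positions w ! (t - 1) = j" "tau w j = length (pos_positions w) + t" by metis
  have ge: "\<not> tau w j - 1 < length (pos_positions w)"
    and idx: "tau w j - 1 - length (pos_positions w) = t - 1" "t - 1 < length (neg_positions w)"
    using t by auto
  show ?thesis
    unfolding unsigned_letter_def unsigned_word_def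
    using ge idx neg t(2) by (simp add: nth_append abs_letter_def)
qed

text \<open>Positive positions fill the first slots in reverse order, negative ones the later slots
  in order. So a negative \<open>k\<close> lands behind every smaller position, and a positive
  \<open>k\<close> in front of it.\<close>

lemma tau_less_iff:
  assumes j: "j \<in> {1..length w}" and k: "k \<in> {1..length w}" and "j < k"
  shows "tau w j < tau w k \<longleftrightarrow> letter w k < 0"
proof -
  have index_less: "t < s" if "sorted xs" "t \<in> {1..length xs}" "xs ! (t - 1) = j" "xs ! (s - 1) = k" for xs t s
  proof (rule ccontr)
    assume "\<not> t < s"
    then have "xs ! (s - 1) \<le> xs ! (t - 1)" using that by (intro sorted_nth_mono) auto
    then show False using that \<open>j < k\<close> by linarith
  qed
  have sorted: "sorted (pos_positions w)" "sorted (neg_positions w)"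
    by (simp_all add: pos_positions_def neg_positions_def sorted_filter[where f = id, simplified] del: upt_Suc)
  note nz = letter_range(1)[OF j] letter_range(1)[OF k]
  consider "letter w j > 0" "letter w k > 0" | "letter w j > 0" "letter w k < 0"
    | "letter w j < 0" "letter w k > 0" | "letter w j < 0" "letter w k < 0"
    using nz by linarith
  then show ?thesis
  proof cases
    case 1
    obtain t where t: "t \<in> {1..length (pos_positions w)}" "pos_positions w ! (t - 1) = j"
      "tau w j = length (pos_positions w) + 1 - t" using pos_positionE[OF j 1(1)] by metis
    obtain s where s: "s \<in> {1..length (pos_positions w)}" "pos_positions w ! (s - 1) = k"
      "tau w k = length (pos_positions w) + 1 - s" using pos_positionE[OF k 1(2)] by metis
    have "t < s"
      by (rule index_less[OF sorted(1) t(1,2) s(2)])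
    then show ?thesis using t(1,3) s(1,3) 1 by auto
  next
    case 2
    obtain t where "t \<in> {1..length (pos_positions w)}" "tau w j = length (pos_positions w) + 1 - t"
      using pos_positionE[OF j 2(1)] by metis
    moreover obtain s where "s \<in> {1..length (neg_positions w)}" "tau w k = length (pos_positions w) + s"
      using neg_positionE[OF k 2(2)] by metis
    ultimately show ?thesis using 2 by auto
  next
    case 3
    obtain t where "t \<in> {1..length (neg_positions w)}" "tau w j = length (pos_positions w) + t"
      using neg_positionE[OF j 3(1)] by metis
    moreover obtain s where "s \<in> {1..length (pos_positions w)}" "tau w k = length (pos_positions w) + 1 - s"
      using pos_positionE[OF k 3(2)] by metis
    ultimately show ?thesis using 3 by auto
  next
    case 4
    obtain t where t: "t \<in> {1..length (neg_positions w)}" "neg_positions w ! (t - 1) = j"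
      "tau w j = length (pos_positions w) + t" using neg_positionE[OF j 4(1)] by metis
    obtain s where s: "s \<in> {1..length (neg_positions w)}" "neg_positions w ! (s - 1) = k"
      "tau w k = length (pos_positions w) + s" using neg_positionE[OF k 4(2)] by metis
    have "t < s"
      by (rule index_less[OF sorted(2) t(1,2) s(2)])
    then show ?thesis using t(1,3) s(1,3) 4 by auto
  qed
qed

text \<open>For \<open>j < k\<close> the second clause is impossible, and the first and third
  together only ask that \<open>k\<close> be negative; for \<open>k < j\<close> the third drops out
  and only the sign at \<open>j\<close> matters.\<close>

lemma P_pairs_iff:
  assumes j: "j \<in> {1..length w}" and k: "k \<in> {1..length w}" and "j \<noteq> k"
  shows "(j, k) \<in> P_pairs w \<longleftrightarrow> (if j < k then letter w k < 0 else letter w j > 0)"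
  using assms letter_range(1)[OF j] letter_range(1)[OF k]
  by (auto simp: P_pairs_def eps_def sgn_if split: if_splits)

text \<open>This pulls the strict upper triangle of \<open>Q_unsigned\<close> back along
  \<open>tau\<close> to the index pairs used by \<open>Q_signed\<close>.\<close>

lemma P_pairs_iff_tau_less:
  assumes j: "j \<in> {1..length w}" and k: "k \<in> {1..length w}" and "j \<noteq> k"
  shows "(j, k) \<in> P_pairs w \<longleftrightarrow> tau w j < tau w k"
proof -
  \<comment> \<open>For \<open>k < j\<close>, \<open>tau_less_iff\<close> only decides
    \<open>tau w k < tau w j\<close>; distinctness turns its negation into
    \<open>tau w j < tau w k\<close>.\<close>
  have "tau w j \<noteq> tau w k"
    using permutes_inj[OF tau_permutes[OF w]] \<open>j \<noteq> k\<close> by (auto dest: injD)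
  then show ?thesis
    using P_pairs_iff[OF assms] tau_less_iff[OF j k] tau_less_iff[OF k j] \<open>j \<noteq> k\<close>
      letter_range(1)[OF j] by (cases j k rule: linorder_cases) auto
qed

section \<open>Conjugation by \<open>tau\<close> and the factorization of
  \<open>M_hat\<close>\<close>

lemma perm_mat_congruence_Q_unsigned:
  "transpose_mat (perm_mat (length w) (tau w)) * Q_unsigned A w * perm_mat (length w) (tau w)
    = Q_signed A w"
proof (rule mat_eq_entryI)
  fix j k assume jk: "j \<in> {1..length w}" "k \<in> {1..length w}"
  have p: "tau w permutes {1..length w}" by (rule tau_permutes[OF w])
  have range: "tau w j \<in> {1..length w}" "tau w k \<in> {1..length w}"
    using p jk by (simp_all add: permutes_in_image del: atLeastAtMost_iff)
  have inj: "tau w j = tau w k \<longleftrightarrow> j = k"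
    using permutes_inj[OF p] by (auto dest: injD)
  have "entry (transpose_mat (perm_mat (length w) (tau w)) * Q_unsigned A w *
      perm_mat (length w) (tau w)) j k = entry (Q_unsigned A w) (tau w j) (tau w k)"
    by (rule entry_perm_mat_congruence[OF _ p jk]) (simp add: Q_unsigned_def)
  also have "\<dots> = entry (Q_signed A w) j k"
    using P_pairs_iff_tau_less[OF jk] unsigned_letter_tau[OF jk(1)] unsigned_letter_tau[OF jk(2)]
    unfolding Q_unsigned_def Q_signed_def entry_mat_of_entries[OF range] entry_mat_of_entries[OF jk] inj
    by auto
  finally show "entry (transpose_mat (perm_mat (length w) (tau w)) * Q_unsigned A w *
      perm_mat (length w) (tau w)) j k = entry (Q_signed A w) j k" .
qed (auto simp: perm_mat_def Q_signed_def Q_unsigned_def intro!: mult_carrier_mat[where n = "length w"])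

text \<open>Both successor maps search for the next equal letter, and the unsigned letter at slot
  \<open>tau w j\<close> is the absolute letter at \<open>j\<close>.\<close>

lemma E_tau_eq_E_signed: "E_tau w = E_signed w"
  unfolding E_tau_def E_signed_def s_tau_def succ_pos_def
  by (intro succ_mat_cong next_equal_cong unsigned_letter_tau)

lemma M_hat_eq: "M_hat A w = transpose_mat (E_signed w) * Q_signed A w * E_signed w"
proof -
  let ?n = "length w"
  let ?T = "perm_mat ?n (tau w)" and ?E = "E_signed w" and ?Q = "Q_unsigned A w"
  have T: "?T \<in> carrier_mat ?n ?n" and E: "?E \<in> carrier_mat ?n ?n" and Q: "?Q \<in> carrier_mat ?n ?n"
    by (simp_all add: perm_mat_def E_signed_def succ_mat_def Q_unsigned_def)
  have "M_hat A w = transpose_mat ?E * transpose_mat ?T * ?Q * (?T * ?E)"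
    unfolding M_hat_def Let_def E_tau_eq_E_signed transpose_mult[OF T E] ..
  \<comment> \<open>The brackets move so that the middle factor becomes the conjugate of
    \<open>Q_unsigned\<close> by \<open>tau\<close>.\<close>
  also have "\<dots> = transpose_mat ?E * (transpose_mat ?T * ?Q * ?T) * ?E"
  proof -
    note assoc = assoc_mult_mat[of _ ?n ?n _ ?n _ ?n]
    have T': "transpose_mat ?T \<in> carrier_mat ?n ?n" and E': "transpose_mat ?E \<in> carrier_mat ?n ?n"
      using T E by simp_all
    have TQ: "transpose_mat ?T * ?Q \<in> carrier_mat ?n ?n" and TQT: "transpose_mat ?T * ?Q * ?T \<in> carrier_mat ?n ?n"
      using T T' Q by (meson mult_carrier_mat)+
    have "transpose_mat ?E * transpose_mat ?T * ?Q * (?T * ?E)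
        = transpose_mat ?E * (transpose_mat ?T * ?Q) * (?T * ?E)"
      by (simp only: assoc[OF E' T' Q])
    also have "\<dots> = transpose_mat ?E * (transpose_mat ?T * ?Q * (?T * ?E))"
      by (rule assoc[OF E' TQ]) (use T E in simp)
    also have "\<dots> = transpose_mat ?E * (transpose_mat ?T * ?Q * ?T * ?E)"
      by (simp only: assoc[OF TQ T E])
    also have "\<dots> = transpose_mat ?E * (transpose_mat ?T * ?Q * ?T) * ?E"
      by (rule assoc[OF E' TQT E, symmetric])
    finally show ?thesis .
  qed
  finally show ?thesis unfolding perm_mat_congruence_Q_unsigned .
qed

section \<open>Order signs and the explicit entries\<close>

lemma eps_cases:
  assumes "\<And>i. x = enat i \<Longrightarrow> i \<in> {1..length w}"
  shows "eps w x = 1 \<or> eps w x = -1"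
proof (cases x)
  case (enat i)
  then have "letter w i \<noteq> 0" using letter_range(1) assms by blast
  then show ?thesis using enat by (auto simp: eps_def sgn_if)
qed (simp add: eps_def)

(* The correction at infinite y does not depend on x, so it cancels in the difference of two rows.
   A diagonal entry is 1 = (a/2) (1 + 0), since there a = 2. *)
lemma ext_entry_Q_signed:
  assumes A: "generalized_Cartan_matrix r A"
    and x: "\<And>i. x = enat i \<Longrightarrow> i \<in> {1..length w} \<and> abs_letter w i = c"
    and y: "\<And>i. y = enat i \<Longrightarrow> i \<in> {1..length w} \<and> abs_letter w i = d"
  shows "2 * ext_entry (Q_signed A w) x y
    = entry A c d * (1 + order_sign w x y - (if y = \<infinity> then 2 else 0))"
proof (cases x)
  case x': (enat i)
  show ?thesis
  proof (cases y)
    case y': (enat l)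
    have i: "i \<in> {1..length w}" "abs_letter w i = c" and l: "l \<in> {1..length w}" "abs_letter w l = d"
      using x[OF x'] y[OF y'] by auto
    have Q: "ext_entry (Q_signed A w) x y
      = (if i = l then 1 else if (i, l) \<in> P_pairs w then entry A c d else 0)"
      using x' y' i l by (simp add: ext_entry_def Q_signed_def entry_mat_of_entries del: atLeastAtMost_iff)
    show ?thesis
    proof (cases "i = l")
      case True
      then have "entry A c d = 2"
        using A i l letter_range(2)[OF i(1)] by (auto simp: generalized_Cartan_matrix_def)
      then show ?thesis using Q True x' y' by (simp add: order_sign_def row_less_def)
    next
      case False
      \<comment> \<open>By \<open>P_pairs_iff\<close> the order sign is 1 on \<open>P_pairs\<close>
        and -1 on the other pairs of distinct positions.\<close>
      then show ?thesis
        unfolding Q using P_pairs_iff[OF i(1) l(1) False] x' y'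
          letter_range(1)[OF i(1)] letter_range(1)[OF l(1)]
        by (auto simp: order_sign_def row_less_def eps_def sgn_if)
    qed
  \<comment> \<open>For infinite \<open>y\<close> the order sign is 1 and the bracket is 1 + 1 - 2 =
    0; for infinite \<open>x\<close> and finite \<open>y\<close> it is 1 - 1 = 0.\<close>
  qed (simp add: x' ext_entry_def order_sign_def row_less_def eps_def)
qed (cases y; simp add: ext_entry_def order_sign_def row_less_def eps_def)

text \<open>In each relative order of \<open>j\<close>, \<open>k\<close> and their successors, order
  signs cancel. What survives is 0, a single sign when the Cartan entry is 2, or a sum or difference
  of two signs, which is 0 or twice one of them.\<close>

lemma m_hat_formula_order_sign:
  assumes A: "generalized_Cartan_matrix r A"
    and j: "j \<in> {1..length w}" and k: "k \<in> {1..length w}"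
  shows "2 * m_hat_formula A w j k = entry A (abs_letter w j) (abs_letter w k) *
    (order_sign w (enat j) (enat k) - order_sign w (succ_pos w j) (enat k)
     - order_sign w (enat j) (succ_pos w k) + order_sign w (succ_pos w j) (succ_pos w k))"
proof -
  define x y a where "x = succ_pos w j" and "y = succ_pos w k"
    and "a = entry A (abs_letter w j) (abs_letter w k)"
  have jx: "enat j < x" and ky: "enat k < y"
    using succ_posD(1) unfolding x_def y_def by (metis enat_ord_simps(2) enat_ord_code(4) not_enat_eq)+
  have eq: "abs_letter w j = abs_letter w k" if "x = enat k \<or> y = enat j"
    using that succ_posD(3) unfolding x_def y_def by metis
  \<comment> \<open>A successor carries the same letter up to sign, so \<open>a\<close> is a
    diagonal Cartan entry here; its value 2 absorbs the factor 2 on the left of the claim.\<close>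
  have a2: "a = 2" if "j = k \<or> x = enat k \<or> y = enat j"
    using that eq A letter_range(2)[OF j] unfolding a_def generalized_Cartan_matrix_def by metis
  \<comment> \<open>With a common finite successor both positions would carry the same absolute
    letter, and the larger would lie strictly between the smaller and that successor, against
    minimality.\<close>
  have xy: "x \<noteq> y \<or> x = \<infinity>" if "j \<noteq> k"
  proof (rule ccontr)
    assume "\<not> ?thesis"
    then obtain i where i: "succ_pos w j = enat i" "succ_pos w k = enat i"
      unfolding x_def y_def by auto
    show False
      using succ_posD[OF i(1)] succ_posD[OF i(2)] that by (metis linorder_neqE_nat)
  qed
  \<comment> \<open>All four signs are 1 or -1, also at infinity. Hence a sum of two is nonzero
    exactly when they agree, a difference exactly when they are opposite: these are the sign
    conditions of the formula.\<close>
  have e: "eps w (enat j) = 1 \<or> eps w (enat j) = -1" "eps w (enat k) = 1 \<or> eps w (enat k) = -1"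
    "eps w x = 1 \<or> eps w x = -1" "eps w y = 1 \<or> eps w y = -1"
    using j k succ_posD(2) unfolding x_def y_def by (auto intro!: eps_cases simp del: atLeastAtMost_iff)
  have formula: "m_hat_formula A w j k =
    (if x = enat k then - eps w (enat k)
     else if enat j = y then eps w (enat j)
     else if j = k \<and> y = \<infinity> then 1
     else if j < k \<and> enat k < x \<and> row_less x y \<and> eps w (enat k) = eps w x \<or>
             j < k \<and> enat k < y \<and> y < x \<and> eps w (enat k) = - eps w y
       then - eps w (enat k) * a
     else if k < j \<and> enat j < y \<and> y < x \<and> eps w (enat j) = eps w y \<or>
             k < j \<and> enat j < x \<and> row_less x y \<and> eps w (enat j) = - eps w x
       then eps w (enat j) * a
     else 0)"
    unfolding m_hat_formula_def Let_def x_def y_def a_def ..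
  note os = order_sign_simps
  have "2 * m_hat_formula A w j k = a *
    (order_sign w (enat j) (enat k) - order_sign w x (enat k)
     - order_sign w (enat j) y + order_sign w x y)"
  proof (cases j k rule: linorder_cases)
    case less
    have jk: "enat j < enat k" using less by simp
    have neq: "enat j \<noteq> y" "j \<noteq> k" "\<not> k < j" and jy: "enat j < y"
      using less_trans[OF jk ky] less by auto
    \<comment> \<open>In these five cases the bracket is 0, -eps(k), -eps(k) - eps(x), the same with
      eps(x) = -1, and eps(y) - eps(k).\<close>
    consider "x < enat k" | "x = enat k" | "enat k < x" "x < y" | "x = \<infinity>" "y = \<infinity>"
      | "enat k < x" "y < x"
      using xy[OF neq(2)] by (metis linorder_neqE enat_ord_code(4))
    then show ?thesis
    proof cases
      case 1
      then have "x < y" "\<not> enat k < x" "x \<noteq> enat k" "\<not> y < x" using ky by auto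
      then show ?thesis unfolding formula using less 1 neq jk jx ky jy by (simp add: os)
    next
      case 2
      then have "x < y" "a = 2" using ky a2 by auto
      then show ?thesis unfolding formula using less 2 jk jx ky jy by (simp add: os)
    next
      case 3
      then have "x \<noteq> enat k" "row_less x y" "\<not> y < x" by (auto simp: row_less_def)
      then show ?thesis unfolding formula using less 3 neq jk jx ky jy e by (auto simp: os)
    next
      case 4
      then have "row_less x y" by (simp add: row_less_def)
      then show ?thesis unfolding formula using less 4 neq jk e(2) by (auto simp: os eps_def[of w \<infinity>])
    next
      case 5
      then have "x \<noteq> enat k" "\<not> row_less x y" using ky by (auto simp: row_less_def)
      then show ?thesis unfolding formula using less 5 neq jk jx ky jy e by (auto simp: os)
    qed
  next
    case equal
    \<comment> \<open>The two mixed order signs cancel, leaving that of \<open>x\<close> with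
      itself: 0 if \<open>x\<close> is finite and 1 if not. With \<open>a = 2\<close> the diagonal
      entry is 0 or 1.\<close>
    then have "x = y" unfolding x_def y_def by simp
    moreover have "a = 2" using equal a2 by simp
    ultimately show ?thesis unfolding formula using equal jx
      by (cases y) (simp_all add: os eps_def[of w \<infinity>])
  next
    case greater
    have jk: "enat k < enat j" using greater by simp
    have neq: "enat k \<noteq> x" "k \<noteq> j" "\<not> j < k" and jy: "enat k < x"
      using less_trans[OF jk jx] greater by auto
    \<comment> \<open>In these five cases the bracket is 0, eps(j), eps(j) - eps(x), the same with
      eps(x) = -1, and eps(j) + eps(y).\<close>
    consider "y < enat j" | "y = enat j" | "enat j < y" "x < y" | "x = \<infinity>" "y = \<infinity>"
      | "enat j < y" "y < x"
      using xy[OF neq(2)[symmetric]] by (metis linorder_neqE enat_ord_code(4))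
    then show ?thesis
    proof cases
      case 1
      then have "y < x" "\<not> enat j < y" "y \<noteq> enat j" "\<not> row_less x y" using jx by (auto simp: row_less_def)
      then show ?thesis unfolding formula using greater 1 neq jk jx ky jy by (simp add: os)
    next
      case 2
      then have "y < x" "a = 2" using jx a2 by auto
      then show ?thesis unfolding formula using greater 2 neq jk jx ky jy by (simp add: os)
    next
      case 3
      then have "y \<noteq> enat j" "row_less x y" "\<not> y < x" by (auto simp: row_less_def)
      then show ?thesis unfolding formula using greater 3 neq jk jx ky jy e by (auto simp: os)
    next
      case 4
      then have "row_less x y" by (simp add: row_less_def)
      then show ?thesis unfolding formula using greater 4 neq jk e(1) by (auto simp: os eps_def[of w \<infinity>])
    next
      case 5
      then have "y \<noteq> enat j" "\<not> row_less x y" using jx by (auto simp: row_less_def)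
      then show ?thesis unfolding formula using greater 5 neq jk jx ky jy e by (auto simp: os)
    qed
  qed
  then show ?thesis unfolding x_def y_def a_def .
qed

end

section \<open>The factorization and the entry formula combined\<close>

theorem theorem5p4p5:
  fixes A :: "int mat" and r :: nat and w :: "int list"
  assumes "generalized_Cartan_matrix r A" and "symmetrizable r A"
    and "signed_word r w"
  shows "M_hat A w \<in> carrier_mat (length w) (length w) \<and>
    M_hat A w = transpose_mat (E_signed w) * Q_signed A w * E_signed w \<and>
    (\<forall>j\<in>{1..length w}. \<forall>k\<in>{1..length w}. entry (M_hat A w) j k = m_hat_formula A w j k)"
proof (intro conjI ballI)
  let ?n = "length w"
  note w = assms(3)
  show M: "M_hat A w = transpose_mat (E_signed w) * Q_signed A w * E_signed w"
    by (rule M_hat_eq[OF w])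
  have E: "E_signed w \<in> carrier_mat ?n ?n" by (simp add: E_signed_def succ_mat_def)
  then show "M_hat A w \<in> carrier_mat ?n ?n"
    unfolding M using Q_signed_carrier by auto
  fix j k assume jk: "j \<in> {1..?n}" "k \<in> {1..?n}"
  let ?q = "ext_entry (Q_signed A w)" and ?x = "succ_pos w j" and ?y = "succ_pos w k"
  have s: "i \<in> {1..?n} \<and> abs_letter w i = abs_letter w l" if "succ_pos w l = enat i" for i l
    using succ_posD(1-3)[OF that] by auto
  have m: "entry (M_hat A w) j k
      = ?q (enat j) (enat k) - ?q ?x (enat k) - ?q (enat j) ?y + ?q ?x ?y"
    unfolding M E_signed_def
    by (rule entry_succ_mat_congruence[OF Q_signed_carrier jk]) (use s in blast)
  \<comment> \<open>A finite successor has the absolute letter of its position, so one Cartan entry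
    serves all four terms. Doubling keeps the identity in the integers.\<close>
  have q: "2 * ?q x y = entry A (abs_letter w j) (abs_letter w k) *
      (1 + order_sign w x y - (if y = \<infinity> then 2 else 0))"
    if "x \<in> {enat j, ?x}" "y \<in> {enat k, ?y}" for x y
    by (rule ext_entry_Q_signed[OF w assms(1)]) (use that jk s in auto)
  have "2 * entry (M_hat A w) j k = 2 * m_hat_formula A w j k"
    unfolding m_hat_formula_order_sign[OF w assms(1) jk] m
    using q[of "enat j" "enat k"] q[of ?x "enat k"] q[of "enat j" ?y] q[of ?x ?y]
    by (simp add: algebra_simps)
  then show "entry (M_hat A w) j k = m_hat_formula A w j k" by simp
qed

end
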